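(* Let $\mathcal{P}$ be a finite index set, $\{A_p : p\in\mathcal{P}\}$ a collection of stable real $n\times n$ matrices and $\mathcal{R}=\{R_{(p,q)} : p,q\in\mathcal{P}\}$ a collection of real $n\times n$ matrices. Assume that for some positive constants $\{\tau_p\}_{p\in\mathcal{P}}$ there exists a collection of symmetric positive definite matrices $\{Q_p\in M_n(\mathbb{R}) : p\in\mathcal{P}\}$ such that $$Q_pA_p+A_p^\top Q_p<0\quad\text{for all }p\in\mathcal{P},\qquad e^{A_q^\top\tau_q}R_{(q,p)}^\top Q_pR_{(q,p)}e^{A_q\tau_q}\le Q_q\quad\text{for all }p,q\in\mathcal{P}.$$ Then the reset switched system $\dot x(t)=A_{\sigma(t)}x(t)$, $x(t_k)=R_{(\sigma(t_{k-1}),\sigma(t_k))}\,x(t_k^-)$ ($k\ge1$) is stable for all signals $\sigma\in\mathcal{S}_s^M\left(\{\tau_p\}_{p\in\mathcal{P}}\right)$.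
   Context: A real matrix is called stable if all its eigenvalues have negative real part. For symmetric matrices, $<$ and $\le$ denote the (strict and non-strict) Loewner order. A switching signal is a right-continuous piecewise constant function $\sigma:[0,\infty)\to\mathcal{P}$ whose set of discontinuities $\{t_k\}_{k\ge1}$ (switching times) is an increasing sequence with $t_k\uparrow\infty$; put $t_0=0$. $\mathcal{S}_s^M(\{\tau_p\}_{p\in\mathcal{P}})$ is the set of switching signals with $t_{k+1}-t_k\ge\tau_{\sigma(t_k)}$ for all $k\ge0$. In the reset switched system, $\dot x=A_{\sigma(t)}x$ holds on each $[t_{k-1},t_k)$ and $x(t_k^-)=\lim_{t\to t_k^-}x(t)$. The system (for fixed $\sigma$) is stable if for every $\epsilon>0$ there is $\delta>0$ such that $\|x(0)\|<\delta$ implies $\|x(t)\|<\epsilon$ for all $t>0$ (Euclidean norm). *)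

theory Defs
  imports "HOL-Analysis.Analysis"
begin

text \<open>The product \<open>*\<close> on the type \<open>real^'n^'n\<close> is componentwise, so the library's \<open>exp\<close>
  and \<open>^\<close> are not the matrix exponential and the matrix power.\<close>

definition matrix_power :: "real^'n^'n \<Rightarrow> nat \<Rightarrow> real^'n^'n" where
  "matrix_power A k = (((**) A) ^^ k) (mat 1)"

definition matrix_exp :: "real^'n^'n \<Rightarrow> real^'n^'n" where
  "matrix_exp A = (\<Sum>k. (1 / fact k) *\<^sub>R matrix_power A k)"

text \<open>Eigenvalues of a real matrix are taken over the complex numbers.\<close>

definition eigenvalue :: "real^'n^'n \<Rightarrow> complex \<Rightarrow> bool" where
  "eigenvalue A l \<longleftrightarrow> (\<exists>v. v \<noteq> 0 \<and> map_matrix complex_of_real A *v v = l *s v)"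

definition stable_matrix :: "real^'n^'n \<Rightarrow> bool" where
  "stable_matrix A \<longleftrightarrow> (\<forall>l. eigenvalue A l \<longrightarrow> Re l < 0)"

definition sym_pos_def :: "real^'n^'n \<Rightarrow> bool" where
  "sym_pos_def M \<longleftrightarrow> transpose M = M \<and> (\<forall>v. v \<noteq> 0 \<longrightarrow> v \<bullet> (M *v v) > 0)"

definition sym_pos_semidef :: "real^'n^'n \<Rightarrow> bool" where
  "sym_pos_semidef M \<longleftrightarrow> transpose M = M \<and> (\<forall>v. v \<bullet> (M *v v) \<ge> 0)"

text \<open>The orders \<open><\<close> and \<open>\<le>\<close> of the library on \<open>real^'n^'n\<close> are entrywise.\<close>

definition loewner_less :: "real^'n^'n \<Rightarrow> real^'n^'n \<Rightarrow> bool" (infix "\<prec>\<^sub>L" 50) where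
  "M \<prec>\<^sub>L N \<longleftrightarrow> sym_pos_def (N - M)"

definition loewner_le :: "real^'n^'n \<Rightarrow> real^'n^'n \<Rightarrow> bool" (infix "\<preceq>\<^sub>L" 50) where
  "M \<preceq>\<^sub>L N \<longleftrightarrow> sym_pos_semidef (N - M)"

text \<open>Signals are functions on \<open>[0,\<infinity>)\<close>; their values at negative times are irrelevant.
  Index sets carry the discrete topology, so continuity at a point means being eventually equal
  to the value at that point.\<close>

definition discontinuities :: "(real \<Rightarrow> 'p) \<Rightarrow> real set" where
  "discontinuities \<sigma> = {s. s \<ge> 0 \<and> \<not> (\<forall>\<^sub>F r in at s within {0..}. \<sigma> r = \<sigma> s)}"

definition switching_times :: "(real \<Rightarrow> 'p) \<Rightarrow> (nat \<Rightarrow> real) \<Rightarrow> bool" where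
  "switching_times \<sigma> t \<longleftrightarrow>
     t 0 = 0 \<and> strict_mono t \<and> filterlim t at_top sequentially \<and>
     discontinuities \<sigma> = t ` {1..}"

text \<open>The switching times of a signal are determined by the signal.\<close>

lemma switching_times_unique:
  assumes "switching_times \<sigma> t" "switching_times \<sigma> u"
  shows "t = u"
proof -
  have r: "range w = insert 0 (discontinuities \<sigma>)" if "switching_times \<sigma> w" for w
  proof -
    have "(UNIV :: nat set) = insert 0 {1..}" by auto
    then have "range w = insert (w 0) (w ` {1..})" by (metis image_insert)
    then show ?thesis using that by (simp add: switching_times_def)
  qed
  have st: "strict_mono t" and su: "strict_mono u"
    using assms by (auto simp: switching_times_def)
  have rg: "range t = range u" using r assms by simp
  have "t n = u n" for n
  proof (induction n rule: less_induct)
    case (less n)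
    obtain m where m: "t n = u m" using rg by (metis rangeE rangeI)
    obtain k where k: "u n = t k" using rg by (metis rangeE rangeI)
    have "\<not> m < n" using less m st by (metis strict_mono_eq less_irrefl)
    moreover have "\<not> k < n" using less k su by (metis strict_mono_eq less_irrefl)
    ultimately have "u n \<le> u m" "t n \<le> t k"
      using st su by (simp_all add: strict_mono_less_eq)
    then show ?case using m k by simp
  qed
  then show ?thesis by auto
qed

definition switching_signal :: "'p set \<Rightarrow> (real \<Rightarrow> 'p) \<Rightarrow> bool" where
  "switching_signal P \<sigma> \<longleftrightarrow>
     \<sigma> ` {0..} \<subseteq> P \<and>
     (\<forall>s\<ge>0. \<forall>\<^sub>F r in at_right s. \<sigma> r = \<sigma> s) \<and>
     (\<exists>t. switching_times \<sigma> t \<and> (\<forall>k. \<sigma> constant_on {t k<..<t (Suc k)}))"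

text \<open>The class \<open>S_s^M({\<tau>_p})\<close>: the dwell time in a mode is at least the bound of that mode.\<close>

definition mode_dwell_signals :: "'p set \<Rightarrow> ('p \<Rightarrow> real) \<Rightarrow> (real \<Rightarrow> 'p) set" where
  "mode_dwell_signals P \<tau> =
     {\<sigma>. switching_signal P \<sigma> \<and>
          (\<exists>t. switching_times \<sigma> t \<and> (\<forall>k. t (Suc k) - t k \<ge> \<tau> (\<sigma> (t k))))}"

text \<open>At the left end point \<open>t k\<close> the derivative below is the right derivative; the vector
  \<open>y\<close> is the left limit of \<open>x\<close> at \<open>t (Suc k)\<close>.\<close>

definition reset_solution ::
  "('p \<Rightarrow> real^'n^'n) \<Rightarrow> ('p \<times> 'p \<Rightarrow> real^'n^'n) \<Rightarrow> (real \<Rightarrow> 'p) \<Rightarrow> (real \<Rightarrow> real^'n) \<Rightarrow> bool"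
  where
  "reset_solution A R \<sigma> x \<longleftrightarrow>
     (\<exists>t. switching_times \<sigma> t \<and>
       (\<forall>k. (\<forall>s\<in>{t k..<t (Suc k)}.
               (x has_vector_derivative A (\<sigma> s) *v x s) (at s within {t k..<t (Suc k)})) \<and>
            (\<exists>y. (x \<longlongrightarrow> y) (at_left (t (Suc k))) \<and>
                 x (t (Suc k)) = R (\<sigma> (t k), \<sigma> (t (Suc k))) *v y)))"

definition stable_reset_system ::
  "('p \<Rightarrow> real^'n^'n) \<Rightarrow> ('p \<times> 'p \<Rightarrow> real^'n^'n) \<Rightarrow> (real \<Rightarrow> 'p) \<Rightarrow> bool" where
  "stable_reset_system A R \<sigma> \<longleftrightarrow>
     (\<forall>\<epsilon>>0. \<exists>\<delta>>0. \<forall>x. reset_solution A R \<sigma> x \<longrightarrow> norm (x 0) < \<delta> \<longrightarrow>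
        (\<forall>t>0. norm (x t) < \<epsilon>))"

end

theory Submission
  imports Defs
begin

text \<open>The value of the quadratic form of the active mode, \<open>V s = x s \<bullet> (Q (\<sigma> s) *v x s)\<close>, never
  exceeds its initial value. It does not increase between two switching times, by the Lyapunov
  inequality. At a switch out of mode \<open>q\<close> the left limit of the state is \<open>exp (\<tau> q A q) z\<close>, where
  \<open>z\<close> is the state a time \<open>\<tau> q\<close> earlier; the dwell time condition puts that moment in the same
  interval, and the second matrix inequality bounds \<open>V\<close> after the reset by the value at \<open>z\<close>.
  The forms of the finitely many modes have a common positive lower bound on the unit sphere.\<close>

section \<open>Matrix powers and the exponential series\<close>

lemma matrix_power_0 [simp]: "matrix_power A 0 = mat 1"
  by (simp add: matrix_power_def)

lemma matrix_power_Suc: "matrix_power A (Suc k) = A ** matrix_power A k"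
  by (simp add: matrix_power_def)

lemma matrix_power_commute: "matrix_power A k ** A = A ** matrix_power A k"
  by (induction k) (simp_all add: matrix_power_Suc flip: matrix_mul_assoc)

lemma matrix_power_transpose:
  "matrix_power (transpose A) k = transpose (matrix_power A k)"
proof (induction k)
  case (Suc k)
  have "matrix_power (transpose A) (Suc k) = transpose A ** transpose (matrix_power A k)"
    using Suc by (simp add: matrix_power_Suc)
  also have "\<dots> = transpose (matrix_power A (Suc k))"
    by (simp add: matrix_power_Suc matrix_power_commute flip: matrix_transpose_mul)
  finally show ?case .
qed simp

lemma matrix_power_scaleR: "matrix_power (c *\<^sub>R A) k = c ^ k *\<^sub>R matrix_power A k"
  by (induction k) (simp_all add: matrix_power_Suc matrix_scalar_ac mult.commute
      flip: scalar_matrix_assoc)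

lemma norm_matrix_power_vector_le:
  "norm (matrix_power A k *v v) \<le> onorm ((*v) A) ^ k * norm v"
proof (induction k)
  case (Suc k)
  have bl: "bounded_linear ((*v) A)"
    by (rule matrix_vector_mul_bounded_linear)
  have "norm (matrix_power A (Suc k) *v v) \<le> onorm ((*v) A) * norm (matrix_power A k *v v)"
    using onorm[OF bl] by (simp add: matrix_power_Suc flip: matrix_vector_mul_assoc)
  also have "\<dots> \<le> onorm ((*v) A) * (onorm ((*v) A) ^ k * norm v)"
    using Suc onorm_pos_le[OF bl] by (rule mult_left_mono)
  finally show ?case by (simp add: mult.assoc)
qed simp

text \<open>The norm on \<open>real^'n^'n\<close> is the Euclidean norm of all entries. Each entry
  is a coordinate of the image of a unit vector, hence bounded by the k-th power of the operator
  norm; summing over the n entries of a row and then over the n rows gives the factor n^2.\<close>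

lemma norm_matrix_power_le:
  fixes A :: "real^'n^'n"
  shows "norm (matrix_power A k) \<le> real CARD('n) * (real CARD('n) * onorm ((*v) A) ^ k)"
proof -
  have entry: "\<bar>matrix_power A k $ i $ j\<bar> \<le> onorm ((*v) A) ^ k" for i j
  proof -
    have "\<bar>matrix_power A k $ i $ j\<bar> = \<bar>(matrix_power A k *v axis j 1) $ i\<bar>"
      by (simp add: matrix_vector_mul_component inner_axis)
    also have "\<dots> \<le> norm (matrix_power A k *v axis j 1)"
      by (rule component_le_norm_cart)
    also have "\<dots> \<le> onorm ((*v) A) ^ k"
      using norm_matrix_power_vector_le[of A k "axis j 1"] by (simp add: norm_axis_1)
    finally show ?thesis .
  qed
  have row: "norm (matrix_power A k $ i) \<le> real CARD('n) * onorm ((*v) A) ^ k" for i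
    by (rule order_trans[OF norm_le_l1_cart]) (use sum_bounded_above[of UNIV] entry in force)
  have "norm (matrix_power A k) \<le> (\<Sum>i\<in>UNIV. norm (matrix_power A k $ i))"
    unfolding norm_vec_def by (rule L2_set_le_sum) simp
  also have "\<dots> \<le> real CARD('n) * (real CARD('n) * onorm ((*v) A) ^ k)"
    using sum_bounded_above[of UNIV] row by force
  finally show ?thesis .
qed

lemma summable_matrix_exp: "summable (\<lambda>k. (1 / fact k) *\<^sub>R matrix_power (A :: real^'n^'n) k)"
proof (rule summable_comparison_test')
  let ?N = "real CARD('n)"
  show "summable (\<lambda>k. ?N * ?N * (inverse (fact k) * onorm ((*v) A) ^ k))"
    by (intro summable_mult summable_exp)
  show "norm ((1 / fact k) *\<^sub>R matrix_power A k)
      \<le> ?N * ?N * (inverse (fact k) * onorm ((*v) A) ^ k)" if "k \<ge> 0" for k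
    using mult_left_mono[OF norm_matrix_power_le[of A k], of "1 / fact k"]
    by (simp add: field_simps)
qed

text \<open>Transposition is bounded and linear, so it passes through the series term by term. This
  turns the left exponential in the second matrix inequality into the transpose of the right
  one.\<close>

lemma matrix_exp_transpose: "matrix_exp (transpose A) = transpose (matrix_exp A)"
proof -
  have "linear (transpose :: real^'n^'n \<Rightarrow> real^'n^'n)"
    by (rule linearI) (simp_all add: transpose_def vec_eq_iff)
  then have "bounded_linear (transpose :: real^'n^'n \<Rightarrow> real^'n^'n)"
    by (simp add: linear_conv_bounded_linear)
  from bounded_linear.suminf[OF this summable_matrix_exp, of A] show ?thesis
    by (simp add: matrix_exp_def matrix_power_transpose transpose_scalar)
qed

lemma matrix_exp_vector_sums:
  fixes A :: "real^'n^'n"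
  shows "(\<lambda>k. (1 / fact k) *\<^sub>R (matrix_power A k *v v)) sums (matrix_exp A *v v)"
proof -
  have "linear (\<lambda>M :: real^'n^'n. M *v v)"
    by (rule linearI) (simp_all add: matrix_vector_mult_add_rdistrib scaleR_matrix_vector_assoc)
  then have "bounded_linear (\<lambda>M :: real^'n^'n. M *v v)"
    by (simp add: linear_conv_bounded_linear)
  from bounded_linear.sums[OF this summable_sums[OF summable_matrix_exp]]
  show ?thesis
    by (simp add: matrix_exp_def scaleR_matrix_vector_assoc)
qed

section \<open>Flows of x' = A x and the exponential\<close>

text \<open>Asking for the derivative only in the open interval lets the value at \<open>b\<close>
  be a left limit; together with continuity it is what the mean value theorem requires.\<close>

definition linear_flow :: "real^'n^'n \<Rightarrow> (real \<Rightarrow> real^'n) \<Rightarrow> real \<Rightarrow> real \<Rightarrow> bool" where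
  "linear_flow A u a b \<longleftrightarrow> continuous_on {a..b} u \<and>
     (\<forall>s\<in>{a<..<b}. (u has_vector_derivative A *v u s) (at s))"

lemma linear_flow_subset:
  assumes "linear_flow A u a b" "a \<le> c" "d \<le> b"
  shows "linear_flow A u c d"
  using assms by (auto simp: linear_flow_def elim: continuous_on_subset)

text \<open>The partial sums \<open>\<Sum>k<n. ((b - s)^k / k!) A^k (u s)\<close> of \<open>exp ((b - s) A) (u s)\<close> have a
  derivative in \<open>s\<close> that telescopes to the single term below, which tends to \<open>0\<close> uniformly
  as \<open>n\<close> grows; at \<open>s = b\<close> their value is \<open>u b\<close>.\<close>

lemma exp_partial_sum_derivative:
  assumes "(u has_vector_derivative A *v u s) (at s)"
  shows "((\<lambda>s. \<Sum>k<Suc n. ((b - s) ^ k / fact k) *\<^sub>R (matrix_power A k *v u s))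
    has_vector_derivative ((b - s) ^ n / fact n) *\<^sub>R (matrix_power A (Suc n) *v u s)) (at s)"
proof (induction n)
  case 0
  show ?case using assms by (simp add: matrix_power_Suc)
next
  case (Suc n)
  have 1: "((\<lambda>s. matrix_power A (Suc n) *v u s) has_vector_derivative
      matrix_power A (Suc n) *v (A *v u s)) (at s)"
    by (rule bounded_linear.has_vector_derivative[OF matrix_vector_mul_bounded_linear assms])
  have 2: "((\<lambda>s. (b - s) ^ Suc n / fact (Suc n)) has_real_derivative
      - ((b - s) ^ n / fact n)) (at s)"
  proof -
    have "((\<lambda>s. (b - s) ^ Suc n) has_real_derivative - (real (Suc n) * (b - s) ^ n)) (at s)"
      by (rule derivative_eq_intros refl | simp)+
    from DERIV_cdivide[OF this, of "fact (Suc n)"] show ?thesis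
      by (simp add: fact_Suc del: of_nat_Suc power_Suc)
  qed
  have 3: "matrix_power A (Suc n) *v (A *v u s) = matrix_power A (Suc (Suc n)) *v u s"
    by (simp only: matrix_power_Suc[of A "Suc n"] matrix_vector_mul_assoc matrix_power_commute)
  from has_vector_derivative_add[OF Suc has_vector_derivative_scaleR[OF 2 1]]
  show ?case unfolding 3 by (simp add: sum.lessThan_Suc[of _ "Suc n"])
qed

text \<open>By the mean value theorem the values of the partial sums at \<open>a\<close> and
  \<open>b\<close> differ by a quantity tending to 0. At \<open>a\<close> they converge to the
  exponential series applied to \<open>u a\<close>, at \<open>b\<close> they are constantly
  \<open>u b\<close>.\<close>

lemma linear_flow_exp:
  assumes flow: "linear_flow A u a b" and ab: "a < b"
  shows "u b = matrix_exp ((b - a) *\<^sub>R A) *v u a"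
proof -
  define K where "K = onorm ((*v) A)"
  have K0: "K \<ge> 0"
    unfolding K_def by (rule onorm_pos_le[OF matrix_vector_mul_bounded_linear])
  define f where "f n s = (\<Sum>k<n. ((b - s) ^ k / fact k) *\<^sub>R (matrix_power A k *v u s))"
    for n :: nat and s
  have cont: "continuous_on {a..b} u"
    and der: "\<And>s. s \<in> {a<..<b} \<Longrightarrow> (u has_vector_derivative A *v u s) (at s)"
    using flow by (auto simp: linear_flow_def)
  obtain M where M: "\<And>s. s \<in> {a..b} \<Longrightarrow> norm (u s) \<le> M"
    using compact_imp_bounded[OF compact_continuous_image[OF cont compact_Icc]]
    unfolding bounded_iff by (metis imageI)
  have bound: "norm (f (Suc n) b - f (Suc n) a)
      \<le> (b - a) * K * M * (inverse (fact n) * ((b - a) * K) ^ n)" for n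
  proof -
    have "continuous_on {a..b} (f (Suc n))"
      unfolding f_def
      by (intro continuous_intros cont
          bounded_linear.continuous_on[OF matrix_vector_mul_bounded_linear])
        (simp_all add: cont)
    moreover have "(f (Suc n) has_derivative
        (\<lambda>h. h *\<^sub>R (((b - s) ^ n / fact n) *\<^sub>R (matrix_power A (Suc n) *v u s)))) (at s)"
      if "a < s" "s < b" for s
      using exp_partial_sum_derivative[OF der, where n = n and b = b] that
      by (simp add: has_vector_derivative_def f_def[abs_def])
    ultimately obtain s where s: "s \<in> {a<..<b}" and
      le: "norm (f (Suc n) b - f (Suc n) a)
        \<le> norm ((b - a) *\<^sub>R (((b - s) ^ n / fact n) *\<^sub>R (matrix_power A (Suc n) *v u s)))"
      using mvt_general[OF ab, of "f (Suc n)" "\<lambda>s h. h *\<^sub>R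
          (((b - s) ^ n / fact n) *\<^sub>R (matrix_power A (Suc n) *v u s))"] by blast
    note le
    also have "\<dots> = (b - a) * ((b - s) ^ n / fact n) * norm (matrix_power A (Suc n) *v u s)"
      using s ab by (simp add: abs_mult)
    \<comment> \<open>Enlarging \<open>b - s\<close> to \<open>b - a\<close> removes the
      intermediate point \<open>s\<close>, which varies with \<open>n\<close>. What remains is a
      constant times a term of a convergent exponential series.\<close>
    also have "\<dots> \<le> (b - a) * ((b - a) ^ n / fact n) * (K ^ Suc n * M)"
    proof (rule mult_mono)
      show "(b - a) * ((b - s) ^ n / fact n) \<le> (b - a) * ((b - a) ^ n / fact n)"
        using s ab by (intro mult_left_mono divide_right_mono power_mono) auto
      have "norm (matrix_power A (Suc n) *v u s) \<le> K ^ Suc n * norm (u s)"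
        unfolding K_def by (rule norm_matrix_power_vector_le)
      also have "\<dots> \<le> K ^ Suc n * M"
        using M[of s] s K0 by (intro mult_left_mono) auto
      finally show "norm (matrix_power A (Suc n) *v u s) \<le> K ^ Suc n * M" .
    qed (use ab in auto)
    also have "\<dots> = (b - a) * K * M * (inverse (fact n) * ((b - a) * K) ^ n)"
      by (simp add: power_mult_distrib divide_inverse mult_ac)
    finally show ?thesis .
  qed
  \<comment> \<open>At the right end point only the term of index 0 survives. The shift to
    \<open>Suc n\<close> matters: \<open>f 0 b\<close> is an empty sum.\<close>
  have fb: "f (Suc n) b = u b" for n
    by (induction n) (simp_all add: f_def)
  have "(\<lambda>n. inverse (fact n) * ((b - a) * K) ^ n) \<longlonglongrightarrow> 0"
    by (rule summable_LIMSEQ_zero[OF summable_exp])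
  then have "(\<lambda>n. (b - a) * K * M * (inverse (fact n) * ((b - a) * K) ^ n)) \<longlonglongrightarrow> 0"
    by (rule tendsto_mult_right_zero)
  then have "(\<lambda>n. f (Suc n) b - f (Suc n) a) \<longlonglongrightarrow> 0"
    by (rule Lim_null_comparison[rotated]) (use bound in auto)
  then have "(\<lambda>n. u b - (f (Suc n) b - f (Suc n) a)) \<longlonglongrightarrow> u b - 0"
    by (intro tendsto_intros)
  then have "(\<lambda>n. f (Suc n) a) \<longlonglongrightarrow> u b"
    by (simp add: fb)
  moreover have "(\<lambda>n. f n a) \<longlonglongrightarrow> matrix_exp ((b - a) *\<^sub>R A) *v u a"
    using matrix_exp_vector_sums[of "(b - a) *\<^sub>R A" "u a"]
    by (simp add: sums_def f_def matrix_power_scaleR scaleR_matrix_vector_assoc[symmetric])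
  ultimately show ?thesis
    using LIMSEQ_unique LIMSEQ_Suc by blast
qed

section \<open>Quadratic forms: decay, resets and lower bounds\<close>

lemma inner_transpose_left: "v \<bullet> (transpose B *v w) = (B *v v) \<bullet> (w :: real^'n)"
  by (metis transpose_matrix_vector dot_lmul_matrix inner_commute)

text \<open>By the product rule the derivative of the form along the flow is the form of Q A + A^T Q
  at \<open>u s\<close>, which the Lyapunov inequality makes nonpositive.\<close>

lemma lyapunov_nonincreasing:
  assumes flow: "linear_flow A u a b" and ab: "a \<le> b"
    and lyap: "Q ** A + transpose A ** Q \<prec>\<^sub>L 0"
  shows "u b \<bullet> (Q *v u b) \<le> u a \<bullet> (Q *v u a)"
  using ab
proof (rule DERIV_nonpos_imp_decreasing_open[where f = "\<lambda>s. u s \<bullet> (Q *v u s)"])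
  show "continuous_on {a..b} (\<lambda>s. u s \<bullet> (Q *v u s))"
    using flow by (auto simp: linear_flow_def intro!: continuous_intros
        bounded_linear.continuous_on[OF matrix_vector_mul_bounded_linear])
  fix s assume "a < s" "s < b"
  then have d: "(u has_vector_derivative A *v u s) (at s)"
    using flow by (auto simp: linear_flow_def)
  have dQ: "((\<lambda>s. Q *v u s) has_vector_derivative Q *v (A *v u s)) (at s)"
    by (rule bounded_linear.has_vector_derivative[OF matrix_vector_mul_bounded_linear d])
  let ?D = "u s \<bullet> (Q *v (A *v u s)) + (A *v u s) \<bullet> (Q *v u s)"
  have "((\<lambda>s. u s \<bullet> (Q *v u s)) has_vector_derivative ?D) (at s)"
    by (rule bounded_bilinear.has_vector_derivative[OF bounded_bilinear_inner d dQ])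
  moreover have "?D = u s \<bullet> ((Q ** A + transpose A ** Q) *v u s)"
    by (simp add: matrix_vector_mult_add_rdistrib inner_add_right inner_transpose_left
        del: transpose_matrix_vector flip: matrix_vector_mul_assoc)
  moreover have "v \<bullet> ((Q ** A + transpose A ** Q) *v v) \<le> 0" for v
  proof (cases "v = 0")
    case False
    then have "0 < v \<bullet> ((0 - (Q ** A + transpose A ** Q)) *v v)"
      using lyap unfolding loewner_less_def sym_pos_def_def by blast
    then show ?thesis
      by (simp only: matrix_vector_mult_diff_rdistrib inner_diff_right matrix_vector_mult_0) simp
  qed simp
  ultimately show "\<exists>y. ((\<lambda>s. u s \<bullet> (Q *v u s)) has_real_derivative y) (at s) \<and> y \<le> 0"
    by (metis has_real_derivative_iff_has_vector_derivative)
qed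

text \<open>After substituting for \<open>y\<close> and moving factors across the inner product by
  transposition, the left side is the form at \<open>z\<close> of the matrix product in the
  hypothesis.\<close>

lemma reset_form_le:
  assumes "matrix_exp (h *\<^sub>R transpose A) ** transpose R ** Q ** R ** matrix_exp (h *\<^sub>R A) \<preceq>\<^sub>L Q'"
    and "y = matrix_exp (h *\<^sub>R A) *v z"
  shows "(R *v y) \<bullet> (Q *v (R *v y)) \<le> z \<bullet> (Q' *v z)"
proof -
  let ?E = "matrix_exp (h *\<^sub>R A)"
  have E: "matrix_exp (h *\<^sub>R transpose A) = transpose ?E"
    by (simp add: transpose_scalar flip: matrix_exp_transpose)
  have "0 \<le> z \<bullet> ((Q' - transpose ?E ** transpose R ** Q ** R ** ?E) *v z)"
    using assms(1) by (simp add: loewner_le_def sym_pos_semidef_def E)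
  then show ?thesis
    by (simp add: assms(2) matrix_vector_mult_diff_rdistrib inner_diff_right inner_transpose_left
        del: transpose_matrix_vector flip: matrix_vector_mul_assoc)
qed

text \<open>The minimum of the form on the compact unit sphere is positive and serves as the
  constant, since the form is homogeneous of degree 2.\<close>

lemma sym_pos_def_lower_bound:
  assumes "sym_pos_def (Q :: real^'n^'n)"
  obtains c where "c > 0" "\<And>v. c * (norm v)\<^sup>2 \<le> v \<bullet> (Q *v v)"
proof -
  have "continuous_on (sphere 0 1) (\<lambda>v. v \<bullet> (Q *v v))"
    by (auto intro!: continuous_intros
        bounded_linear.continuous_on[OF matrix_vector_mul_bounded_linear])
  moreover have "axis undefined 1 \<in> sphere (0 :: real^'n) 1"
    by (simp add: norm_axis_1)
  ultimately obtain w :: "real^'n" where w: "norm w = 1"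
    and min: "\<And>v. norm v = 1 \<Longrightarrow> w \<bullet> (Q *v w) \<le> v \<bullet> (Q *v v)"
    using continuous_attains_inf[of "sphere (0 :: real^'n) 1"] by fastforce
  show thesis
  proof
    show "w \<bullet> (Q *v w) > 0"
      using assms w by (metis sym_pos_def_def norm_zero zero_neq_one)
    fix v :: "real^'n"
    show "w \<bullet> (Q *v w) * (norm v)\<^sup>2 \<le> v \<bullet> (Q *v v)"
    proof (cases "v = 0")
      case False
      then have "w \<bullet> (Q *v w) \<le> (v /\<^sub>R norm v) \<bullet> (Q *v (v /\<^sub>R norm v))"
        by (intro min) simp
      with False show ?thesis
        by (simp add: matrix_vector_mult_scaleR field_simps power2_eq_square)
    qed simp
  qed
qed

lemma sym_pos_def_uniform_lower_bound:
  assumes "finite P" and "\<And>p. p \<in> P \<Longrightarrow> sym_pos_def (Q p :: real^'n^'n)"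
  obtains c where "c > 0" "\<And>p v. p \<in> P \<Longrightarrow> c * (norm v)\<^sup>2 \<le> v \<bullet> (Q p *v v)"
proof -
  have "\<forall>p\<in>P. \<exists>c>0. \<forall>v. c * (norm v)\<^sup>2 \<le> v \<bullet> (Q p *v v)"
    using assms(2) sym_pos_def_lower_bound by metis
  then obtain c where c: "\<And>p. p \<in> P \<Longrightarrow> c p > 0"
      "\<And>p v. p \<in> P \<Longrightarrow> c p * (norm v)\<^sup>2 \<le> v \<bullet> (Q p *v v)"
    by metis
  \<comment> \<open>Inserting 1 keeps the minimum defined and positive even for empty
    \<open>P\<close>.\<close>
  let ?m = "Min (insert 1 (c ` P))"
  show thesis
  proof
    show "?m > 0" using assms(1) c(1) by simp
    fix p and v :: "real^'n" assume p: "p \<in> P"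
    have "?m * (norm v)\<^sup>2 \<le> c p * (norm v)\<^sup>2"
      using assms(1) p by (intro mult_right_mono) auto
    also have "\<dots> \<le> v \<bullet> (Q p *v v)" by (rule c(2)[OF p])
    finally show "?m * (norm v)\<^sup>2 \<le> v \<bullet> (Q p *v v)" .
  qed
qed

section \<open>Solutions and signals on one switching interval\<close>

text \<open>A solution may jump at the reset time \<open>b\<close>. Replacing its value there by the
  left limit gives a flow on the closed interval and changes nothing before
  \<open>b\<close>.\<close>

lemma linear_flow_left_limit:
  assumes der: "\<And>s. s \<in> {a..<b} \<Longrightarrow>
      (x has_vector_derivative A *v x s) (at s within {a..<b})"
    and lim: "(x \<longlongrightarrow> y) (at_left b)"
  shows "linear_flow A (x(b := y)) a b"
  unfolding linear_flow_def
proof (intro conjI ballI)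
  show "continuous_on {a..b} (x(b := y))"
    unfolding continuous_on_eq_continuous_within
  proof
    fix s assume s: "s \<in> {a..b}"
    show "continuous (at s within {a..b}) (x(b := y))"
    proof (cases "s = b")
      case True
      have "(x(b := y) \<longlongrightarrow> y) (at b within {..<b})"
        using lim by (rule Lim_transform_eventually) (auto simp: eventually_at_filter)
      then have "(x(b := y) \<longlongrightarrow> y) (at b within {a..<b})"
        by (rule tendsto_within_subset) auto
      \<comment> \<open>The filter of punctured neighbourhoods of \<open>b\<close> ignores
        \<open>b\<close> itself, so both sets induce the same one.\<close>
      moreover have "at b within {a..b} = at b within {a..<b}"
        unfolding at_within_def by (rule arg_cong[where f = "\<lambda>S. inf _ (principal S)"]) auto
      ultimately show ?thesis using True by (simp add: continuous_within)
    next
      case False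
      with s have s: "s \<in> {a..<b}" by simp
      have "continuous (at s within {a..<b}) x"
        by (rule has_vector_derivative_continuous[OF der[OF s]])
      moreover have "at s within {a..<b} = at s within {a..b}"
        by (rule at_within_nhd[of _ "{..<b}"]) (use s in auto)
      ultimately have "(x \<longlongrightarrow> x s) (at s within {a..b})"
        by (simp add: continuous_within)
      moreover have "\<forall>\<^sub>F r in at s within {a..b}. x r = (x(b := y)) r"
        using s by (auto simp: eventually_at dist_real_def intro!: exI[of _ "b - s"])
      ultimately have "(x(b := y) \<longlongrightarrow> x s) (at s within {a..b})"
        by (rule Lim_transform_eventually)
      with False show ?thesis by (simp add: continuous_within)
    qed
  qed
next
  fix s assume s: "s \<in> {a<..<b}"
  then have "(x has_vector_derivative A *v x s) (at s within {a<..<b})"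
    by (intro has_vector_derivative_within_subset[OF der]) auto
  then have "(x has_vector_derivative A *v x s) (at s)"
    using at_within_open[OF s] by simp
  then show "(x(b := y) has_vector_derivative A *v (x(b := y)) s) (at s)"
    using has_vector_derivative_transform_within_open[of x _ s "{a<..<b}" "x(b := y)"] s
    by simp
qed

text \<open>Right continuity supplies a point \<open>r\<close> just after \<open>a\<close> with the
  value at \<open>a\<close>; constancy on the open interval carries this value from \<open>r\<close>
  to \<open>s\<close>.\<close>

lemma constant_between_switches:
  fixes a b :: real
  assumes right: "\<forall>\<^sub>F r in at_right a. \<sigma> r = \<sigma> a" and const: "\<sigma> constant_on {a<..<b}"
    and s: "s \<in> {a..<b}"
  shows "\<sigma> s = \<sigma> a"
proof (cases "s = a")
  case False
  with s have "a < s" "s < b" by auto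
  obtain d where "d > a" and d: "\<And>r. a < r \<Longrightarrow> r < d \<Longrightarrow> \<sigma> r = \<sigma> a"
    using right by (auto simp: eventually_at_right_field)
  obtain r where "a < r" "r < min d s"
    using dense[of a "min d s"] \<open>d > a\<close> \<open>a < s\<close> by auto
  then have "\<sigma> r = \<sigma> a" "r \<in> {a<..<b}" "s \<in> {a<..<b}"
    using d \<open>a < s\<close> \<open>s < b\<close> by auto
  then show ?thesis using const by (metis constant_on_def)
qed simp

text \<open>The switching times are unbounded, so there is a least \<open>n\<close> with
  \<open>s < t n\<close>. It is not 0 because \<open>t 0 = 0\<close>, and its predecessor is the
  required index.\<close>

lemma switching_interval:
  assumes "switching_times \<sigma> t" "s \<ge> 0"
  obtains k where "s \<in> {t k..<t (Suc k)}"
proof -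
  have "\<exists>n. s < t n"
    using assms(1) eventually_happens[OF filterlim_at_top_dense[THEN iffD1, rule_format]]
    by (force simp: switching_times_def)
  then obtain n where n: "s < t n" "\<And>m. m < n \<Longrightarrow> \<not> s < t m"
    using LeastI_ex[of "\<lambda>n. s < t n"] not_less_Least by metis
  with assms have "n \<noteq> 0" by (metis switching_times_def not_le)
  then obtain k where "n = Suc k" by (metis not0_implies_Suc)
  with n show thesis by (intro that[of k]) (auto simp: not_less)
qed

theorem theorem6p3:
  fixes P :: "'p set"
    and A :: "'p \<Rightarrow> real^'n^'n"
    and R :: "'p \<times> 'p \<Rightarrow> real^'n^'n"
    and \<tau> :: "'p \<Rightarrow> real"
    and Q :: "'p \<Rightarrow> real^'n^'n"
  assumes "finite P"
    and "\<And>p. p \<in> P \<Longrightarrow> stable_matrix (A p)"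
    and "\<And>p. p \<in> P \<Longrightarrow> \<tau> p > 0"
    and "\<And>p. p \<in> P \<Longrightarrow> sym_pos_def (Q p)"
    and "\<And>p. p \<in> P \<Longrightarrow> Q p ** A p + transpose (A p) ** Q p \<prec>\<^sub>L 0"
    and "\<And>p q. p \<in> P \<Longrightarrow> q \<in> P \<Longrightarrow>
           matrix_exp (\<tau> q *\<^sub>R transpose (A q)) ** transpose (R (q, p)) ** Q p ** R (q, p)
             ** matrix_exp (\<tau> q *\<^sub>R A q) \<preceq>\<^sub>L Q q"
  shows "\<forall>\<sigma> \<in> mode_dwell_signals P \<tau>. stable_reset_system A R \<sigma>"
proof
  fix \<sigma> assume "\<sigma> \<in> mode_dwell_signals P \<tau>"
  then have sig: "switching_signal P \<sigma>"
    and "\<exists>t. switching_times \<sigma> t \<and> (\<forall>k. t (Suc k) - t k \<ge> \<tau> (\<sigma> (t k)))"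
    by (simp_all add: mode_dwell_signals_def)
  then obtain t where t: "switching_times \<sigma> t"
    and dwell: "\<And>k. t (Suc k) - t k \<ge> \<tau> (\<sigma> (t k))"
    by blast
  have P: "\<And>s. s \<ge> 0 \<Longrightarrow> \<sigma> s \<in> P"
    and right: "\<And>s. s \<ge> 0 \<Longrightarrow> \<forall>\<^sub>F r in at_right s. \<sigma> r = \<sigma> s"
    using sig by (auto simp: switching_signal_def)
  \<comment> \<open>The definitions of dwell class, signal and solution each supply their own
    sequence of switching times; uniqueness identifies them all with \<open>t\<close>, here and for
    solutions below.\<close>
  have const: "\<sigma> constant_on {t k<..<t (Suc k)}" for k
    using sig switching_times_unique[OF t] by (auto simp: switching_signal_def)
  have mono: "strict_mono t" and t_0: "t 0 = 0"
    using t by (simp_all add: switching_times_def)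
  have t_pos: "t k \<ge> 0" for k
    using strict_mono_less_eq[OF mono, of 0 k] t_0 by simp
  have mode: "\<sigma> s = \<sigma> (t k)" if "s \<in> {t k..<t (Suc k)}" for k s
    using constant_between_switches[OF right[OF t_pos] const that] .
  have V_le: "x s \<bullet> (Q (\<sigma> s) *v x s) \<le> x 0 \<bullet> (Q (\<sigma> 0) *v x 0)"
    if sol: "reset_solution A R \<sigma> x" and s: "s \<ge> 0" for x s
  proof -
    obtain t' where "switching_times \<sigma> t'"
      and "\<forall>k. (\<forall>s\<in>{t' k..<t' (Suc k)}.
            (x has_vector_derivative A (\<sigma> s) *v x s) (at s within {t' k..<t' (Suc k)})) \<and>
          (\<exists>y. (x \<longlongrightarrow> y) (at_left (t' (Suc k))) \<and>
            x (t' (Suc k)) = R (\<sigma> (t' k), \<sigma> (t' (Suc k))) *v y)"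
      using sol unfolding reset_solution_def by blast
    moreover from this(1) have "t' = t"
      using t by (rule switching_times_unique)
    ultimately have der: "\<And>k s. s \<in> {t k..<t (Suc k)} \<Longrightarrow>
          (x has_vector_derivative A (\<sigma> s) *v x s) (at s within {t k..<t (Suc k)})"
      and reset: "\<And>k. \<exists>y. (x \<longlongrightarrow> y) (at_left (t (Suc k))) \<and>
          x (t (Suc k)) = R (\<sigma> (t k), \<sigma> (t (Suc k))) *v y"
      by blast+
    define V where "V k = x (t k) \<bullet> (Q (\<sigma> (t k)) *v x (t k))" for k
    \<comment> \<open>The first conjunct is chained over the switches by induction; the second then
      reaches the times inside an interval.\<close>
    have step: "V (Suc k) \<le> V k \<and>
        (\<forall>s\<in>{t k..<t (Suc k)}. x s \<bullet> (Q (\<sigma> s) *v x s) \<le> V k)" for k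
    proof -
      let ?q = "\<sigma> (t k)" and ?p = "\<sigma> (t (Suc k))" and ?b = "t (Suc k)"
      have pq: "?q \<in> P" "?p \<in> P" using P t_pos by auto
      obtain y where y: "(x \<longlongrightarrow> y) (at_left ?b)" "x ?b = R (?q, ?p) *v y"
        using reset by blast
      define u where "u = x(?b := y)"
      have flow: "linear_flow (A ?q) u (t k) ?b"
        unfolding u_def by (rule linear_flow_left_limit[OF _ y(1)]) (use der mode in metis)
      have ux: "u s = x s" if "s < ?b" for s
        using that by (simp add: u_def)
      have dec: "x s \<bullet> (Q ?q *v x s) \<le> V k" if "s \<in> {t k..<?b}" for s
        using lyapunov_nonincreasing[OF linear_flow_subset[OF flow] _ assms(5)[OF pq(1)], of "t k" s]
          that ux[of s] ux[of "t k"] by (simp add: V_def)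
      \<comment> \<open>The dwell condition gives \<open>t k \<le> ?s\<close> and positivity of
        \<open>\<tau> ?q\<close> gives \<open>?s < ?b\<close>. So the flow from \<open>?s\<close> to
        \<open>?b\<close> lasts exactly \<open>\<tau> ?q\<close> and starts at a value of
        \<open>x\<close> itself.\<close>
      let ?s = "?b - \<tau> ?q"
      have s: "?s \<in> {t k..<?b}"
        using dwell[of k] assms(3)[OF pq(1)] by auto
      have "u ?b = matrix_exp ((?b - ?s) *\<^sub>R A ?q) *v u ?s"
        by (rule linear_flow_exp[OF linear_flow_subset[OF flow]])
          (use s assms(3)[OF pq(1)] in auto)
      then have "y = matrix_exp (\<tau> ?q *\<^sub>R A ?q) *v x ?s"
        using s ux[of ?s] by (simp add: u_def)
      then have "V (Suc k) \<le> x ?s \<bullet> (Q ?q *v x ?s)"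
        unfolding V_def y(2) by (rule reset_form_le[OF assms(6)[OF pq(2,1)]])
      also have "\<dots> \<le> V k" by (rule dec[OF s])
      finally show ?thesis using dec mode by metis
    qed
    have "V k \<le> V 0" for k
      using step by (induction k) (auto intro: order_trans)
    moreover obtain k where "s \<in> {t k..<t (Suc k)}"
      using switching_interval[OF t s] .
    ultimately have "x s \<bullet> (Q (\<sigma> s) *v x s) \<le> V 0"
      using step order_trans by blast
    then show ?thesis by (simp add: V_def t_0)
  qed
  obtain c where c: "c > 0" "\<And>p v. p \<in> P \<Longrightarrow> c * (norm v)\<^sup>2 \<le> v \<bullet> (Q p *v v)"
    using sym_pos_def_uniform_lower_bound[of P Q] assms(1,4) by metis
  show "stable_reset_system A R \<sigma>"
    unfolding stable_reset_system_def
  proof (intro allI impI)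
    fix \<epsilon> :: real assume \<epsilon>: "\<epsilon> > 0"
    \<comment> \<open>The form of the initial mode is continuous and vanishes at 0, so small initial
      states keep it below \<open>c * \<epsilon>\<^sup>2\<close>. Under that level the common lower
      bound forces the norm below \<epsilon>.\<close>
    have "isCont (\<lambda>v. v \<bullet> (Q (\<sigma> 0) *v v)) 0"
      by (intro continuous_intros bounded_linear.continuous[OF matrix_vector_mul_bounded_linear])
    moreover have "c * \<epsilon>\<^sup>2 > 0" using c(1) \<epsilon> by simp
    ultimately obtain \<delta> where \<delta>: "\<delta> > 0"
        "\<And>v. norm v < \<delta> \<Longrightarrow> \<bar>v \<bullet> (Q (\<sigma> 0) *v v)\<bar> < c * \<epsilon>\<^sup>2"
      unfolding continuous_at_eps_delta by (auto simp: dist_norm)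
    show "\<exists>\<delta>>0. \<forall>x. reset_solution A R \<sigma> x \<longrightarrow> norm (x 0) < \<delta> \<longrightarrow> (\<forall>t>0. norm (x t) < \<epsilon>)"
    proof (intro exI[of _ \<delta>] conjI allI impI \<delta>(1))
      fix x and s :: real
      assume x: "reset_solution A R \<sigma> x" "norm (x 0) < \<delta>" and s: "s > 0"
      have "c * (norm (x s))\<^sup>2 \<le> x s \<bullet> (Q (\<sigma> s) *v x s)"
        using c(2) P s by simp
      also have "\<dots> \<le> x 0 \<bullet> (Q (\<sigma> 0) *v x 0)"
        using V_le x(1) s by simp
      also have "\<dots> < c * \<epsilon>\<^sup>2"
        using \<delta>(2)[OF x(2)] by simp
      finally have "(norm (x s))\<^sup>2 < \<epsilon>\<^sup>2" using c(1) by simp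
      then show "norm (x s) < \<epsilon>"
        by (rule power2_less_imp_less) (use \<epsilon> in simp)
    qed
  qed
qed

end
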